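(* Let $k\ge2$ be an integer, let $\alpha>0$, and let $\gamma$ denote Euler's constant. Then the entropies of the densities $\phi_\alpha^{(k)}$, $\psi_\alpha^{(k)}$, $\lambda^{(k)}$ of the limit laws of the $k$-th extreme are as follows. (i) (Fréchet) $\displaystyle h(\phi_\alpha^{(k)})=-\log\frac{\alpha}{(k-1)!}-\frac{\alpha k+1}{\alpha}\left(-\gamma+\sum_{i=1}^{k-1}\frac1i\right)+k$; (ii) (Weibull) $\displaystyle h(\psi_\alpha^{(k)})=-\log\frac{\alpha}{(k-1)!}-\frac{\alpha k-1}{\alpha}\left(-\gamma+\sum_{i=1}^{k-1}\frac1i\right)+k$; (iii) (Gumbel) $\displaystyle h(\lambda^{(k)})=\log (k-1)!-k\left(-\gamma+\sum_{i=1}^{k-1}\frac1i\right)+k$.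
   Context: Entropy: for a probability density $p$ on $\mathbb{R}$, $h(p)=-\int_{\{p>0\}}p(x)\log p(x)\,dx$ (natural logarithm). For a max stable law $G$ with density $g$, $g^{(k)}(x)=g(x)\frac{(-\log G(x))^{k-1}}{(k-1)!}$ is the density of the distribution function $G(x)\sum_{i=0}^{k-1}\frac{(-\log G(x))^i}{i!}$. Explicitly, for the Fréchet, Weibull and Gumbel laws respectively: $\phi_\alpha^{(k)}(x)=\frac{\alpha}{(k-1)!}x^{-\alpha k-1}e^{-x^{-\alpha}}$ for $x>0$ and $0$ for $x\le0$; $\psi_\alpha^{(k)}(x)=\frac{\alpha}{(k-1)!}(-x)^{\alpha k-1}e^{-(-x)^\alpha}$ for $x<0$ and $0$ for $x\ge0$; $\lambda^{(k)}(x)=\frac{1}{(k-1)!}e^{-kx}e^{-e^{-x}}$ for $x\in\mathbb{R}$. *)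

theory Defs
  imports "HOL-Analysis.Analysis"
begin

definition differential_entropy :: "(real \<Rightarrow> real) \<Rightarrow> real" where
  "differential_entropy p = - (LINT x:{x. p x > 0}|lborel. p x * ln (p x))"

(* The Bochner integral is 0 for non-integrable functions, so the value of differential_entropy
   is meaningful only together with this predicate. *)
definition has_finite_entropy :: "(real \<Rightarrow> real) \<Rightarrow> bool" where
  "has_finite_entropy p \<longleftrightarrow> set_integrable lborel {x. p x > 0} (\<lambda>x. p x * ln (p x))"

definition frechet_density :: "real \<Rightarrow> nat \<Rightarrow> real \<Rightarrow> real" where
  "frechet_density \<alpha> k x =
     (if x > 0 then \<alpha> / fact (k - 1) * x powr (- \<alpha> * real k - 1) * exp (- (x powr (- \<alpha>))) else 0)"

definition weibull_density :: "real \<Rightarrow> nat \<Rightarrow> real \<Rightarrow> real" where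
  "weibull_density \<alpha> k x =
     (if x < 0 then \<alpha> / fact (k - 1) * (- x) powr (\<alpha> * real k - 1) * exp (- ((- x) powr \<alpha>)) else 0)"

definition gumbel_density :: "nat \<Rightarrow> real \<Rightarrow> real" where
  "gumbel_density k x = 1 / fact (k - 1) * exp (- (real k * x)) * exp (- exp (- x))"

(* These are the functions g * (- ln G) ^ (k - 1) / (k - 1)!, where G is the max stable
   distribution function and g = G' its density. *)

lemma frechet_density_eq:
  fixes \<alpha> :: real
  assumes "k \<ge> 1" "x > 0"
  defines "G \<equiv> \<lambda>x. exp (- (x powr (- \<alpha>)))"
  shows "frechet_density \<alpha> k x = deriv G x * (- ln (G x)) ^ (k - 1) / fact (k - 1)"
proof -
  have d: "deriv G x = \<alpha> * x powr (- \<alpha> - 1) * exp (- (x powr (- \<alpha>)))"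
    unfolding G_def using assms(2)
    by (intro DERIV_imp_deriv) (auto intro!: derivative_eq_intros)
  have e: "- \<alpha> * real k - 1 = (- \<alpha> - 1) + (- \<alpha>) * real (k - 1)"
    using assms(1) by (simp add: of_nat_diff algebra_simps)
  have "x powr (- \<alpha> * real k - 1) = x powr ((- \<alpha> - 1) + (- \<alpha>) * real (k - 1))"
    by (simp only: e)
  also have "\<dots> = x powr (- \<alpha> - 1) * (x powr (- \<alpha>)) ^ (k - 1)"
    using assms(2) by (subst powr_add) (simp add: powr_powr flip: powr_realpow)
  finally show ?thesis
    using assms(2) d by (simp add: frechet_density_def G_def)
qed

lemma weibull_density_eq:
  fixes \<alpha> :: real
  assumes "k \<ge> 1" "x < 0"
  defines "G \<equiv> \<lambda>x. exp (- ((- x) powr \<alpha>))"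
  shows "weibull_density \<alpha> k x = deriv G x * (- ln (G x)) ^ (k - 1) / fact (k - 1)"
proof -
  have d: "deriv G x = \<alpha> * (- x) powr (\<alpha> - 1) * exp (- ((- x) powr \<alpha>))"
    unfolding G_def using assms(2)
    by (intro DERIV_imp_deriv) (auto intro!: derivative_eq_intros)
  have e: "\<alpha> * real k - 1 = (\<alpha> - 1) + \<alpha> * real (k - 1)"
    using assms(1) by (simp add: of_nat_diff algebra_simps)
  have "(- x) powr (\<alpha> * real k - 1) = (- x) powr ((\<alpha> - 1) + \<alpha> * real (k - 1))"
    by (simp only: e)
  also have "\<dots> = (- x) powr (\<alpha> - 1) * ((- x) powr \<alpha>) ^ (k - 1)"
    using assms(2) by (subst powr_add) (simp add: powr_powr flip: powr_realpow)
  finally show ?thesis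
    using assms(2) d by (simp add: weibull_density_def G_def)
qed

lemma gumbel_density_eq:
  assumes "k \<ge> 1"
  defines "G \<equiv> \<lambda>x. exp (- exp (- x))"
  shows "gumbel_density k x = deriv G x * (- ln (G x)) ^ (k - 1) / fact (k - 1)"
proof -
  have d: "deriv G x = exp (- x) * exp (- exp (- x))"
    unfolding G_def
    by (intro DERIV_imp_deriv) (auto intro!: derivative_eq_intros)
  have "exp (- (real k * x)) = exp (- x) ^ k"
    by (simp flip: exp_of_nat_mult)
  also have "\<dots> = exp (- x) * exp (- x) ^ (k - 1)"
    using assms(1) by (cases k) auto
  finally show ?thesis
    using d by (simp add: gumbel_density_def G_def)
qed

end

theory Submission imports Defs begin

section \<open>The Gamma integral and its logarithmic moment\<close>

lemma Gamma_integral_real':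
  assumes "s > (0::real)"
  shows "((\<lambda>t. t powr (s - 1) * exp (- t)) has_integral Gamma s) {0<..}"
proof -
  \<comment> \<open>The open half-line is the exact image of the substitutions \<open>g\<close> used
    later; dropping the single point 0 leaves the integral unchanged.\<close>
  have "((\<lambda>t. if t \<in> {0<..} then t powr (s - 1) / exp t else 0) has_integral Gamma s) {0..}"
    by (rule has_integral_spike[OF _ _ Gamma_integral_real[OF assms], of "{0}"]) auto
  then have "((\<lambda>t. t powr (s - 1) / exp t) has_integral Gamma s) {0<..}"
    by (subst (asm) has_integral_restrict) auto
  then show ?thesis
    by (simp add: exp_minus divide_inverse)
qed

lemma absolutely_integrable_Gamma_integral_real:
  assumes "s > (0::real)"
  shows "(\<lambda>t. t powr (s - 1) * exp (- t)) absolutely_integrable_on {0<..}"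
  using Gamma_integral_real'[OF assms]
  by (intro nonnegative_absolutely_integrable_1) auto

text \<open>Apply \<open>ln u \<le> u - 1\<close> to \<open>u = t powr d\<close> and to
  \<open>u = t powr (- d)\<close>. The logarithm is thus controlled by powers, which only shift the
  shape of a Gamma integral.\<close>

lemma abs_ln_le_powr:
  assumes "t > (0::real)" "d > 0"
  shows "\<bar>ln t\<bar> \<le> (t powr d + t powr (- d)) / d"
proof -
  have "d * ln t \<le> t powr d" "- (d * ln t) \<le> t powr (- d)"
    using ln_le_minus_one[of "t powr d"] ln_le_minus_one[of "t powr (- d)"] assms
    by auto
  moreover have "t powr d \<ge> 0" "t powr (- d) \<ge> 0"
    by auto
  ultimately have "d * \<bar>ln t\<bar> \<le> t powr d + t powr (- d)"
    using assms by (auto simp: abs_if simp del: powr_ge_zero intro: add_increasing add_increasing2)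
  then show ?thesis
    using assms by (simp add: field_simps)
qed

text \<open>The lower bound is the tangent line of \<open>exp\<close> at 0, the upper one is
  weighted AM-GM for \<open>t\<close> and 1 with weights \<open>h\<close> and \<open>1 - h\<close>.
  Neither bound depends on \<open>h\<close>, so one majorant serves all difference
  quotients.\<close>

lemma powr_diff_quotient_bounds:
  assumes "t > (0::real)" "0 < h" "h \<le> 1"
  shows "ln t \<le> (t powr h - 1) / h" "(t powr h - 1) / h \<le> t - 1"
proof -
  have "1 + h * ln t \<le> t powr h"
    using exp_ge_add_one_self[of "h * ln t"] assms by (simp add: powr_def)
  then show "ln t \<le> (t powr h - 1) / h"
    using assms by (simp add: field_simps)
  have "t powr h \<le> h * t + (1 - h)"
    using Youngs_inequality_0[of h "1 - h" t 1] assms by simp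
  then show "(t powr h - 1) / h \<le> t - 1"
    using assms by (simp add: field_simps)
qed

text \<open>Differentiation of the Gamma integral under the integral sign: the difference quotients
  \<open>(t powr h - 1) / h\<close> lie between \<open>ln t\<close> and \<open>t - 1\<close>.\<close>

lemma
  assumes s: "s > (0::real)"
  shows Gamma_integral_ln:
      "((\<lambda>t. ln t * (t powr (s - 1) * exp (- t))) has_integral Gamma s * Digamma s) {0<..}"
        (is "(?f has_integral _) _")
    and absolutely_integrable_Gamma_integral_ln:
      "(\<lambda>t. ln t * (t powr (s - 1) * exp (- t))) absolutely_integrable_on {0<..}"
proof -
  define w where "w = (\<lambda>t::real. t powr (s - 1) * exp (- t))"
  \<comment> \<open>Any \<open>d\<close> strictly between 0 and \<open>s\<close> would do:
    \<open>t powr (- d) * w t\<close> must stay integrable near 0.\<close>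
  define d where "d = s / 2"
  \<comment> \<open>The fraction dominates \<open>\<bar>ln t\<bar>\<close> and \<open>t + 1\<close>
    dominates \<open>\<bar>t - 1\<bar>\<close>; their sum dominates everything between
    \<open>ln t\<close> and \<open>t - 1\<close>.\<close>
  define D where "D = (\<lambda>t::real. (t powr d + t powr (- d)) / d + t + 1)"
  define h where "h = (\<lambda>n. inverse (real (Suc n)))"
  have d: "d > 0" "s - d > 0" and h: "h n > 0" "h n \<le> 1" for n
    using s by (auto simp: d_def h_def field_simps)
  have w0: "w t \<ge> 0" for t
    by (simp add: w_def)
  have D_w: "(\<lambda>t. D t * w t) integrable_on {0<..}"
  proof -
    \<comment> \<open>Absorbing the powers of \<open>t\<close> in \<open>D\<close> into the weight
      gives Gamma integrals of shapes \<open>s + d\<close>, \<open>s - d\<close>,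
      \<open>s + 1\<close> and \<open>s\<close>.\<close>
    have "((\<lambda>t. (t powr (s + d - 1) * exp (- t) + t powr (s - d - 1) * exp (- t)) / d
             + t powr (s + 1 - 1) * exp (- t) + t powr (s - 1) * exp (- t))
           has_integral (Gamma (s + d) + Gamma (s - d)) / d + Gamma (s + 1) + Gamma s) {0<..}"
      using s d
      by (intro has_integral_add has_integral_divide Gamma_integral_real') auto
    then have "((\<lambda>t. D t * w t)
           has_integral (Gamma (s + d) + Gamma (s - d)) / d + Gamma (s + 1) + Gamma s) {0<..}"
    proof (rule has_integral_eq[rotated])
      fix t :: real assume t: "t \<in> {0<..}"
      have "t powr (s + d - 1) = t powr (s - 1) * t powr d"
        "t powr (s - d - 1) = t powr (s - 1) * t powr (- d)"
        "t powr (s + 1 - 1) = t powr (s - 1) * t"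
        using t powr_add[of t "s - 1" d] powr_add[of t "s - 1" "- d"] powr_add[of t "s - 1" 1]
        by (simp_all add: algebra_simps)
      then show "(t powr (s + d - 1) * exp (- t) + t powr (s - d - 1) * exp (- t)) / d
          + t powr (s + 1 - 1) * exp (- t) + t powr (s - 1) * exp (- t) = D t * w t"
        using d by (simp only: D_def w_def) (simp add: field_simps)
    qed
    then show ?thesis
      by blast
  qed
  have ln_D: "\<bar>ln t\<bar> \<le> D t" if "t > 0" for t
    using abs_ln_le_powr[OF that d(1)] that by (simp add: D_def)
  have "((\<lambda>t. ln t * w t) has_integral Gamma s * Digamma s) {0<..}"
  proof (rule has_integral_dominated_convergence[OF _ D_w])
    fix n
    have "((\<lambda>t. (t powr (s + h n - 1) * exp (- t) - t powr (s - 1) * exp (- t)) / h n)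
           has_integral (Gamma (s + h n) - Gamma s) / h n) {0<..}"
      using s h[of n] by (intro has_integral_diff has_integral_divide Gamma_integral_real') auto
    then show "((\<lambda>t. (t powr h n - 1) / h n * w t)
           has_integral (Gamma (s + h n) - Gamma s) / h n) {0<..}"
    proof (rule has_integral_eq[rotated])
      fix t :: real assume t: "t \<in> {0<..}"
      have "t powr (s + h n - 1) = t powr (s - 1) * t powr h n"
        using t by (simp add: algebra_simps flip: powr_add)
      then show "(t powr (s + h n - 1) * exp (- t) - t powr (s - 1) * exp (- t)) / h n =
          (t powr h n - 1) / h n * w t"
        using h[of n] by (simp only: w_def) (simp add: field_simps)
    qed
    have "\<bar>(t powr h n - 1) / h n\<bar> \<le> D t" if "t > 0" for t
    proof -
      have "0 \<le> (t powr d + t powr (- d)) / d"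
        using d by simp
      with powr_diff_quotient_bounds[OF that h[of n]] ln_D[OF that] that show ?thesis
        unfolding D_def by linarith
    qed
    then show "\<forall>t\<in>{0<..}. norm ((t powr h n - 1) / h n * w t) \<le> D t * w t"
      using w0 by (auto simp only: real_norm_def abs_mult abs_of_nonneg greaterThan_iff
          intro!: mult_right_mono)
  next
    have h_lim: "filterlim h (at 0) sequentially"
      using LIMSEQ_inverse_real_of_nat h(1) unfolding h_def filterlim_at
      by (auto intro!: always_eventually)
    show "\<forall>t\<in>{0<..}. (\<lambda>n. (t powr h n - 1) / h n * w t) \<longlonglongrightarrow> ln t * w t"
    proof
      fix t :: real assume "t \<in> {0<..}"
      \<comment> \<open>Since \<open>t powr 0 = 1\<close>, the quotient is a difference quotient in
        the exponent at 0.\<close>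
      then have "((\<lambda>x. t powr x) has_field_derivative ln t) (at 0)"
        by (auto intro!: derivative_eq_intros)
      then have "((\<lambda>x. (t powr x - 1) / x) \<longlongrightarrow> ln t) (at 0)"
        using \<open>t \<in> _\<close> by (simp add: has_field_derivative_iff)
      from filterlim_compose[OF this h_lim]
      show "(\<lambda>n. (t powr h n - 1) / h n * w t) \<longlonglongrightarrow> ln t * w t"
        by (intro tendsto_intros)
    qed
    \<comment> \<open>The integrals are difference quotients of \<open>Gamma\<close> at
      \<open>s\<close>; \<open>Digamma\<close> enters as its logarithmic derivative.\<close>
    have "s \<notin> \<int>\<^sub>\<le>\<^sub>0"
      using s by (auto elim!: nonpos_Ints_cases)
    then have "(Gamma has_field_derivative Gamma s * Digamma s) (at s)"
      by (rule has_field_derivative_Gamma)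
    then have "((\<lambda>x. (Gamma (s + x) - Gamma s) / x) \<longlongrightarrow> Gamma s * Digamma s) (at 0)"
      by (simp add: DERIV_def)
    from filterlim_compose[OF this h_lim]
    show "(\<lambda>n. (Gamma (s + h n) - Gamma s) / h n) \<longlonglongrightarrow> Gamma s * Digamma s" .
  qed
  then show *: "(?f has_integral Gamma s * Digamma s) {0<..}"
    by (simp add: w_def)
  show "?f absolutely_integrable_on {0<..}"
  proof (rule absolutely_integrable_integrable_bound[OF _ _ D_w])
    show "norm (?f t) \<le> D t * w t" if "t \<in> {0<..}" for t
      using that ln_D[of t] w0[of t] by (auto simp: w_def abs_mult intro!: mult_right_mono)
  qed (use * in blast)
qed

section \<open>Entropy by substitution into a Gamma distribution\<close>

text \<open>If \<open>X\<close> has density \<open>p\<close>, the hypothesis \<open>dens\<close> says that \<open>g X\<close> has the Gamma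
  distribution of shape \<open>s\<close>, whose mean is \<open>s\<close> and whose expected logarithm is \<open>Digamma s\<close>.\<close>

lemma entropy_of_Gamma_transform:
  fixes p g g' :: "real \<Rightarrow> real" and s :: real
  assumes s: "s > 0" and p: "p \<in> borel_measurable borel"
    and deriv: "\<And>x. p x > 0 \<Longrightarrow> (g has_field_derivative g' x) (at x)"
    and inj: "inj_on g {x. p x > 0}" and img: "g ` {x. p x > 0} = {0<..}"
    and dens: "\<And>x. p x > 0 \<Longrightarrow> p x = \<bar>g' x\<bar> * (g x powr (s - 1) * exp (- g x) / Gamma s)"
    and ln_p: "\<And>x. p x > 0 \<Longrightarrow> ln (p x) = a + b * ln (g x) - g x"
  shows "has_finite_entropy p \<and> differential_entropy p = - a - b * Digamma s + s"
proof -
  define S where "S = {x. p x > 0}"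
  \<comment> \<open>\<open>F\<close> is the Gamma density times \<open>ln p\<close> written in the
    variable \<open>t = g x\<close>, so that \<open>\<bar>g' x\<bar> * F (g x)\<close> is
    \<open>p x * ln (p x)\<close>.\<close>
  define F where "F = (\<lambda>t. t powr (s - 1) * exp (- t) / Gamma s * (a + b * ln t - t))"
  have S: "S \<in> sets borel"
    unfolding S_def using p by measurable
  have G: "Gamma s > 0" "Gamma (s + 1) = s * Gamma s"
    using s Gamma_plus1[of s] nonpos_Ints_nonpos[of s] by auto
  \<comment> \<open>The three terms are total mass, logarithmic moment and mean; the exponent
    \<open>s + 1 - 1\<close> presents the mean as a Gamma integral of shape
    \<open>s + 1\<close>.\<close>
  have F_eq: "a / Gamma s * (t powr (s - 1) * exp (- t))
      + b / Gamma s * (ln t * (t powr (s - 1) * exp (- t)))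
      - 1 / Gamma s * (t powr (s + 1 - 1) * exp (- t)) = F t" if "t \<in> {0<..}" for t
  proof -
    have "t powr (s + 1 - 1) = t powr (s - 1) * t"
      using that powr_add[of t "s - 1" 1] by simp
    then show ?thesis
      using G by (simp only: F_def) (simp add: field_simps)
  qed
  have "((\<lambda>t. a / Gamma s * (t powr (s - 1) * exp (- t))
      + b / Gamma s * (ln t * (t powr (s - 1) * exp (- t)))
      - 1 / Gamma s * (t powr (s + 1 - 1) * exp (- t))) has_integral
      a / Gamma s * Gamma s + b / Gamma s * (Gamma s * Digamma s) - 1 / Gamma s * Gamma (s + 1))
      {0<..}"
    using s by (intro has_integral_add has_integral_diff has_integral_mult_right
        Gamma_integral_real' Gamma_integral_ln) auto
  from has_integral_eq[OF F_eq this]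
  have F_int: "integral {0<..} F = a + b * Digamma s - s"
    using G by (auto simp: integral_unique)
  have "(\<lambda>t. a / Gamma s * (t powr (s - 1) * exp (- t))
      + b / Gamma s * (ln t * (t powr (s - 1) * exp (- t)))
      - 1 / Gamma s * (t powr (s + 1 - 1) * exp (- t))) absolutely_integrable_on {0<..}"
    using s by (intro set_integral_add set_integral_diff set_integrable_mult_right
        absolutely_integrable_Gamma_integral_real absolutely_integrable_Gamma_integral_ln) auto
  then have F_abs: "F absolutely_integrable_on {0<..}"
    by (subst (asm) set_integrable_cong[OF refl refl F_eq]) auto
  \<comment> \<open>Change of variables yields integrability and value together; the absolute value
    covers decreasing \<open>g\<close>.\<close>
  have "(\<lambda>x. \<bar>g' x\<bar> *\<^sub>R F (g x)) absolutely_integrable_on S \<and>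
      integral S (\<lambda>x. \<bar>g' x\<bar> *\<^sub>R F (g x)) = a + b * Digamma s - s"
    using F_abs F_int img S deriv inj unfolding S_def
    by (subst has_absolute_integral_change_of_variables_real)
      (auto intro: has_field_derivative_at_within)
  moreover have eq: "\<bar>g' x\<bar> *\<^sub>R F (g x) = p x * ln (p x)" if "x \<in> S" for x
  proof -
    have "p x * ln (p x) = \<bar>g' x\<bar> * (g x powr (s - 1) * exp (- g x) / Gamma s)
        * (a + b * ln (g x) - g x)"
      using that dens ln_p unfolding S_def by (intro arg_cong2[where f = "(*)"]) auto
    then show ?thesis
      by (simp add: F_def)
  qed
  ultimately have pl: "(\<lambda>x. p x * ln (p x)) absolutely_integrable_on S"
      "integral S (\<lambda>x. p x * ln (p x)) = a + b * Digamma s - s"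
    by (simp_all cong: set_integrable_cong integral_cong)
  \<comment> \<open>\<open>absolutely_integrable_on\<close> refers to the completed measure, the
    entropy to \<open>lborel\<close>; Borel measurability makes the two integrals agree.\<close>
  have m: "(\<lambda>x. indicator S x *\<^sub>R (p x * ln (p x))) \<in> borel_measurable lborel"
    using p S by measurable
  have "has_finite_entropy p"
    using pl(1) integrable_completion[OF m]
    by (simp add: has_finite_entropy_def set_integrable_def S_def)
  moreover have "(LINT x:S|lborel. p x * ln (p x)) = a + b * Digamma s - s"
    using set_lebesgue_integral_eq_integral(2)[OF pl(1)] pl(2) integral_completion[OF m]
    by (simp add: set_lebesgue_integral_def)
  ultimately show ?thesis
    by (simp add: differential_entropy_def S_def)
qed

section \<open>The three limit densities\<close>

lemma frechet_density_pos_iff: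
  assumes "\<alpha> > 0"
  shows "frechet_density \<alpha> k x > 0 \<longleftrightarrow> x > 0"
  using assms by (simp add: frechet_density_def)

lemma weibull_density_pos_iff:
  assumes "\<alpha> > 0"
  shows "weibull_density \<alpha> k x > 0 \<longleftrightarrow> x < 0"
  using assms by (simp add: weibull_density_def)

lemma gumbel_density_pos: "gumbel_density k x > 0"
  by (simp add: gumbel_density_def)

text \<open>The substitution is \<open>g = - ln G\<close> for the max stable law \<open>G\<close>,
  and the shape is \<open>k\<close>. With \<open>t = g x\<close>,
  \<open>ln x = - ln t / \<alpha>\<close>, which turns the exponent
  \<open>- \<alpha> * k - 1\<close> of \<open>x\<close> into the coefficient
  \<open>(\<alpha> * k + 1) / \<alpha>\<close> of \<open>ln t\<close>.\<close>

lemma entropy_frechet_density: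
  assumes "k \<ge> 1" "\<alpha> > 0"
  shows "has_finite_entropy (frechet_density \<alpha> k) \<and> differential_entropy (frechet_density \<alpha> k) =
    - ln (\<alpha> / fact (k - 1)) - (\<alpha> * real k + 1) / \<alpha> * Digamma (real k) + real k"
proof (rule entropy_of_Gamma_transform[where g = "\<lambda>x. x powr (- \<alpha>)"
      and g' = "\<lambda>x. - \<alpha> * x powr (- \<alpha> - 1)"])
  show "frechet_density \<alpha> k \<in> borel_measurable borel"
    unfolding frechet_density_def by measurable
  show "inj_on (\<lambda>x. x powr (- \<alpha>)) {x. frechet_density \<alpha> k x > 0}"
    using assms by (intro inj_on_inverseI[where g = "\<lambda>y. y powr (- 1 / \<alpha>)"])
      (simp add: frechet_density_pos_iff powr_powr)
  show "(\<lambda>x. x powr (- \<alpha>)) ` {x. frechet_density \<alpha> k x > 0} = {0<..}"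
  proof
    show "{0<..} \<subseteq> (\<lambda>x. x powr (- \<alpha>)) ` {x. frechet_density \<alpha> k x > 0}"
    proof
      fix y :: real assume "y \<in> {0<..}"
      then show "y \<in> (\<lambda>x. x powr (- \<alpha>)) ` {x. frechet_density \<alpha> k x > 0}"
        using assms by (intro image_eqI[of _ _ "y powr (- 1 / \<alpha>)"])
          (auto simp: frechet_density_pos_iff powr_powr)
    qed
  qed (use assms in \<open>auto simp: frechet_density_pos_iff\<close>)
  fix x assume "frechet_density \<alpha> k x > 0"
  then have x: "x > 0"
    using assms by (simp add: frechet_density_pos_iff)
  show "((\<lambda>x. x powr (- \<alpha>)) has_field_derivative - \<alpha> * x powr (- \<alpha> - 1)) (at x)"
    using x by (auto intro!: derivative_eq_intros)
  \<comment> \<open>The first summand is the exponent in \<open>g'\<close>, the second that of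
    \<open>g x powr (k - 1)\<close>.\<close>
  have "- \<alpha> * real k - 1 = (- \<alpha> - 1) + - \<alpha> * (real k - 1)"
    by (simp add: algebra_simps)
  then have "x powr (- \<alpha> * real k - 1) = x powr (- \<alpha> - 1) * (x powr (- \<alpha>)) powr (real k - 1)"
    by (simp only: powr_powr powr_add)
  \<comment> \<open>The normalising constants match because
    \<open>Gamma (real k) = fact (k - 1)\<close> for \<open>k \<ge> 1\<close>.\<close>
  then show "frechet_density \<alpha> k x = \<bar>- \<alpha> * x powr (- \<alpha> - 1)\<bar> *
      ((x powr (- \<alpha>)) powr (real k - 1) * exp (- (x powr (- \<alpha>))) / Gamma (real k))"
    using x assms Gamma_fact[of "k - 1", where 'a = real]
    by (simp add: frechet_density_def abs_mult)
  have "ln (frechet_density \<alpha> k x) =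
      ln (\<alpha> / fact (k - 1)) + (- \<alpha> * real k - 1) * ln x - x powr (- \<alpha>)"
    using x assms by (simp add: frechet_density_def ln_mult ln_div)
  also have "(- \<alpha> * real k - 1) * ln x = (\<alpha> * real k + 1) / \<alpha> * (- \<alpha> * ln x)"
    using assms by (simp add: field_simps)
  finally show "ln (frechet_density \<alpha> k x) = ln (\<alpha> / fact (k - 1))
      + (\<alpha> * real k + 1) / \<alpha> * ln (x powr (- \<alpha>)) - x powr (- \<alpha>)"
    using x by (simp add: ln_powr)
qed (use assms in auto)

text \<open>Again \<open>g = - ln G\<close>; now \<open>ln (- x) = ln t / \<alpha>\<close>, whence
  the coefficient \<open>(\<alpha> * k - 1) / \<alpha>\<close>.\<close>

lemma entropy_weibull_density:
  assumes "k \<ge> 1" "\<alpha> > 0"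
  shows "has_finite_entropy (weibull_density \<alpha> k) \<and> differential_entropy (weibull_density \<alpha> k) =
    - ln (\<alpha> / fact (k - 1)) - (\<alpha> * real k - 1) / \<alpha> * Digamma (real k) + real k"
proof (rule entropy_of_Gamma_transform[where g = "\<lambda>x. (- x) powr \<alpha>"
      and g' = "\<lambda>x. - \<alpha> * (- x) powr (\<alpha> - 1)"])
  show "weibull_density \<alpha> k \<in> borel_measurable borel"
    unfolding weibull_density_def by measurable
  show "inj_on (\<lambda>x. (- x) powr \<alpha>) {x. weibull_density \<alpha> k x > 0}"
    using assms by (intro inj_on_inverseI[where g = "\<lambda>y. - (y powr (1 / \<alpha>))"])
      (simp add: weibull_density_pos_iff powr_powr)
  show "(\<lambda>x. (- x) powr \<alpha>) ` {x. weibull_density \<alpha> k x > 0} = {0<..}"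
  proof
    show "{0<..} \<subseteq> (\<lambda>x. (- x) powr \<alpha>) ` {x. weibull_density \<alpha> k x > 0}"
    proof
      fix y :: real assume "y \<in> {0<..}"
      then show "y \<in> (\<lambda>x. (- x) powr \<alpha>) ` {x. weibull_density \<alpha> k x > 0}"
        using assms by (intro image_eqI[of _ _ "- (y powr (1 / \<alpha>))"])
          (auto simp: weibull_density_pos_iff powr_powr)
    qed
  qed (use assms in \<open>auto simp: weibull_density_pos_iff\<close>)
  fix x assume "weibull_density \<alpha> k x > 0"
  then have x: "x < 0"
    using assms by (simp add: weibull_density_pos_iff)
  show "((\<lambda>x. (- x) powr \<alpha>) has_field_derivative - \<alpha> * (- x) powr (\<alpha> - 1)) (at x)"
    using x by (auto intro!: derivative_eq_intros)
  have "(- x) powr (\<alpha> * real k - 1) = (- x) powr (\<alpha> - 1) * ((- x) powr \<alpha>) powr (real k - 1)"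
    using x by (simp add: powr_powr algebra_simps flip: powr_add)
  then show "weibull_density \<alpha> k x = \<bar>- \<alpha> * (- x) powr (\<alpha> - 1)\<bar> *
      (((- x) powr \<alpha>) powr (real k - 1) * exp (- ((- x) powr \<alpha>)) / Gamma (real k))"
    using x assms Gamma_fact[of "k - 1", where 'a = real]
    by (simp add: weibull_density_def abs_mult)
  have "ln (weibull_density \<alpha> k x) =
      ln (\<alpha> / fact (k - 1)) + (\<alpha> * real k - 1) * ln (- x) - (- x) powr \<alpha>"
    using x assms by (simp add: weibull_density_def ln_mult ln_div)
  also have "(\<alpha> * real k - 1) * ln (- x) = (\<alpha> * real k - 1) / \<alpha> * (\<alpha> * ln (- x))"
    using assms by (simp add: field_simps)
  finally show "ln (weibull_density \<alpha> k x) = ln (\<alpha> / fact (k - 1))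
      + (\<alpha> * real k - 1) / \<alpha> * ln ((- x) powr \<alpha>) - (- x) powr \<alpha>"
    using x by (simp add: ln_powr)
qed (use assms in auto)

text \<open>With \<open>t = exp (- x)\<close> the factor \<open>exp (- (k * x))\<close> is the
  \<open>k\<close>-th power of \<open>t\<close>, so \<open>b = k\<close>. The double negation keeps
  the shape \<open>- a\<close> of the general formula, with
  \<open>a = - ln (fact (k - 1))\<close>.\<close>

lemma entropy_gumbel_density:
  assumes "k \<ge> 1"
  shows "has_finite_entropy (gumbel_density k) \<and> differential_entropy (gumbel_density k) =
    - (- ln (fact (k - 1))) - real k * Digamma (real k) + real k"
proof (rule entropy_of_Gamma_transform[where g = "\<lambda>x. exp (- x)" and g' = "\<lambda>x. - exp (- x)"])
  show "gumbel_density k \<in> borel_measurable borel"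
    unfolding gumbel_density_def by measurable
  show "(\<lambda>x. exp (- x)) ` {x. gumbel_density k x > 0} = {0<..}"
  proof
    show "{0<..} \<subseteq> (\<lambda>x. exp (- x)) ` {x. gumbel_density k x > 0}"
    proof
      fix y :: real assume "y \<in> {0<..}"
      then show "y \<in> (\<lambda>x. exp (- x)) ` {x. gumbel_density k x > 0}"
        by (intro image_eqI[of _ _ "- ln y"]) (auto simp: gumbel_density_pos)
    qed
  qed auto
  \<comment> \<open>The density is positive on the whole line, so the conditions hold at every
    \<open>x\<close>.\<close>
  fix x :: real
  show "((\<lambda>x. exp (- x)) has_field_derivative - exp (- x)) (at x)"
    by (auto intro!: derivative_eq_intros)
  have "exp (- (real k * x)) = exp (- x) * exp (- x) powr (real k - 1)"
    by (simp add: powr_def algebra_simps flip: exp_add)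
  then show "gumbel_density k x = \<bar>- exp (- x)\<bar> *
      (exp (- x) powr (real k - 1) * exp (- exp (- x)) / Gamma (real k))"
    using assms Gamma_fact[of "k - 1", where 'a = real]
    by (simp add: gumbel_density_def)
  show "ln (gumbel_density k x) = - ln (fact (k - 1)) + real k * ln (exp (- x)) - exp (- x)"
    by (simp add: gumbel_density_def ln_mult ln_div)
qed (use assms in \<open>auto simp: inj_on_def\<close>)

section \<open>Harmonic sums and the conclusion\<close>

lemma Digamma_real_of_nat:
  assumes "k \<ge> 1"
  shows "Digamma (real k) = - euler_mascheroni + (\<Sum>i=1..k-1. 1 / real i)"
  \<comment> \<open>\<open>Digamma\<close> at \<open>n + 1\<close> is
    \<open>harm n - euler_mascheroni\<close>; taking \<open>n = k - 1\<close> makes the sum stop at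
    \<open>k - 1\<close>.\<close>
  using Digamma_of_nat[of "k - 1", where 'a = real] assms by (simp add: harm_def inverse_eq_divide)

theorem lemma2p3:
  fixes k :: nat and \<alpha> :: real
  assumes "k \<ge> 2" and "\<alpha> > 0"
  shows
    "(has_finite_entropy (frechet_density \<alpha> k) \<and>
      differential_entropy (frechet_density \<alpha> k) =
        - ln (\<alpha> / fact (k - 1))
        - (\<alpha> * real k + 1) / \<alpha> * (- euler_mascheroni + (\<Sum>i=1..k-1. 1 / real i)) + real k) \<and>
     (has_finite_entropy (weibull_density \<alpha> k) \<and>
      differential_entropy (weibull_density \<alpha> k) =
        - ln (\<alpha> / fact (k - 1))
        - (\<alpha> * real k - 1) / \<alpha> * (- euler_mascheroni + (\<Sum>i=1..k-1. 1 / real i)) + real k) \<and>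
     (has_finite_entropy (gumbel_density k) \<and>
      differential_entropy (gumbel_density k) =
        ln (fact (k - 1))
        - real k * (- euler_mascheroni + (\<Sum>i=1..k-1. 1 / real i)) + real k)"
proof -
  have k: "k \<ge> 1"
    using assms by simp
  show ?thesis
    using entropy_frechet_density[OF k assms(2)] entropy_weibull_density[OF k assms(2)]
      entropy_gumbel_density[OF k] Digamma_real_of_nat[OF k]
    by simp
qed

end
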